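(* Let $\epsilon>0$. Define $\mathcal U:\mathcal H^{\mathrm{cdf}}_\epsilon\to\mathcal H_\epsilon$ by prescribing its Fourier transform: $$\widehat{(\mathcal UH)}(\omega):=-\sqrt{2\pi}\,i\,\omega\,\overline{\widehat H(\omega)},\qquad\omega\in\mathbb R.$$ Then: 1. $\mathcal U$ is a conjugate-linear isometric isomorphism, with $\|\mathcal UH\|_{\mathcal H_\epsilon}=\|H\|_{\mathcal H^{\mathrm{cdf}}_\epsilon}$ for all $H\in\mathcal H^{\mathrm{cdf}}_\epsilon$. 2. For any probability laws $P_1,P_2$ on $\mathbb R$ with $F_{P_1},F_{P_2}\in\Gamma_F$, $\mathcal U(F_{P_1}-F_{P_2})=\Phi(P_1)-\Phi(P_2)$. In particular, $\Phi(P)=\mathcal U(F_P-F_{\delta_0})$ for every law $P$ with $F_P\in\Gamma_F$. 3. $\mathcal U$ is onto $\mathcal H_\epsilon$ and admits a bounded inverse $\mathcal U^{-1}:\mathcal H_\epsilon\to\mathcal H^{\mathrm{cdf}}_\epsilon$ given by $$\widehat{(\mathcal U^{-1}f)}(\omega)=\frac1{\sqrt{2\pi}\,i\,\omega}\overline{\widehat f(\omega)}\quad\text{for a.e. }\omega\in\mathbb R,$$ which also preserves norms: $\|\mathcal U^{-1}f\|_{\mathcal H^{\mathrm{cdf}}_\epsilon}=\|f\|_{\mathcal H_\epsilon}$.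
   Context: $F_P$ and $\phi_P(\omega)=\mathbb E_{X\sim P}[e^{i\omega X}]$ are the cumulative distribution function (CDF) and characteristic function of a probability law $P$ on $\mathbb R$; $F_{\delta_0}(x)=\mathbf 1\{x\ge0\}$. $\Gamma_F$ is the set of CDFs $F$ with $F-F_{\delta_0}\in L^2(\mathbb R)$. Fourier convention: $\widehat f(\omega)=\frac1{\sqrt{2\pi}}\int f(x)e^{-i\omega x}dx$. Elements of the two complex spaces below are specified through their Fourier transforms, which are measurable functions $\mathbb R\to\mathbb C$ modulo a.e. equality; functions in $L^2(\mathbb R)$ are regarded as elements via their usual Fourier transforms. $\mathcal H^{\mathrm{cdf}}_\epsilon$: all $H$ with $\|H\|^2_{\mathcal H^{\mathrm{cdf}}_\epsilon}=\int_{\mathbb R}\frac{\omega^2}{\omega^2+\epsilon}|\widehat H(\omega)|^2d\omega<\infty$, with inner product $\int\frac{\omega^2}{\omega^2+\epsilon}\widehat H_1\overline{\widehat H_2}\,d\omega$. $\mathcal H_\epsilon$: all $f$ with $\|f\|^2_{\mathcal H_\epsilon}=\frac1{2\pi}\int_{\mathbb R}\frac{|\widehat f(\omega)|^2}{\omega^2+\epsilon}d\omega<\infty$, with inner product $\frac1{2\pi}\int\frac{\widehat f\,\overline{\widehat g}}{\omega^2+\epsilon}d\omega$. For a law $P$ with $F_P\in\Gamma_F$, $\Phi(P)\in\mathcal H_\epsilon$ is the element with $\widehat{\Phi(P)}(\omega)=\phi_P(\omega)-1$. *)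

theory Defs
  imports "HOL-Probability.Probability"
begin

text \<open>An element of either Hilbert space is identified with its Fourier transform, i.e. with a
  class of measurable functions modulo a.e. equality. \<open>ft H\<close> is some representative of the
  transform of \<open>H\<close>, determined only up to null sets; \<open>of_ft g\<close> is the element whose transform is
  \<open>g\<close> (meaningful for measurable \<open>g\<close> only).\<close>

quotient_type ft_class = "real \<Rightarrow> complex" /
  partial: "\<lambda>f g. f \<in> borel_measurable lborel \<and> g \<in> borel_measurable lborel \<and>
                   (AE \<omega> in lborel. f \<omega> = g \<omega>)"
  morphisms ft of_ft
proof (rule part_equivpI)
  show "\<exists>f. f \<in> borel_measurable lborel \<and> f \<in> borel_measurable lborel \<and>
            (AE \<omega> in lborel. f \<omega> = (f \<omega> :: complex))"
    by (intro exI[of _ "\<lambda>_. 0"]) simp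
  show "symp (\<lambda>f g. f \<in> borel_measurable lborel \<and> g \<in> borel_measurable lborel \<and>
                   (AE \<omega>::real in lborel. f \<omega> = (g \<omega> :: complex)))"
    by (auto simp: symp_def eq_commute)
  show "transp (\<lambda>f g. f \<in> borel_measurable lborel \<and> g \<in> borel_measurable lborel \<and>
                   (AE \<omega>::real in lborel. f \<omega> = (g \<omega> :: complex)))"
    unfolding transp_def by (auto elim: AE_mp)
qed

lemma ft_measurable [measurable]: "ft H \<in> borel_measurable lborel"
  using Quotient_rep_reflp[OF Quotient_ft_class, of H] by simp

lemma ft_of_ft: "g \<in> borel_measurable lborel \<Longrightarrow> AE \<omega> in lborel. ft (of_ft g) \<omega> = g \<omega>"
  using Quotient_rep_abs[OF Quotient_ft_class, of g] by simp

lemma of_ft_ft: "of_ft (ft H) = H"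
  using Quotient_abs_rep[OF Quotient_ft_class] .

lemma ft_class_eq_iff: "H = K \<longleftrightarrow> (AE \<omega> in lborel. ft H \<omega> = ft K \<omega>)"
  using Quotient_rel_rep[OF Quotient_ft_class, of H K] by simp

instantiation ft_class :: ab_group_add
begin

lift_definition zero_ft_class :: ft_class is "\<lambda>_. 0" by simp

lift_definition plus_ft_class :: "ft_class \<Rightarrow> ft_class \<Rightarrow> ft_class"
  is "\<lambda>f g \<omega>. f \<omega> + g \<omega>" by (auto elim: AE_mp)

lift_definition minus_ft_class :: "ft_class \<Rightarrow> ft_class \<Rightarrow> ft_class"
  is "\<lambda>f g \<omega>. f \<omega> - g \<omega>" by (auto elim: AE_mp)

lift_definition uminus_ft_class :: "ft_class \<Rightarrow> ft_class"
  is "\<lambda>f \<omega>. - f \<omega>" by auto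

instance
  by standard (transfer; simp add: algebra_simps)+

end

lift_definition scale_ft :: "complex \<Rightarrow> ft_class \<Rightarrow> ft_class"  (infixr "*\<^sub>F" 75)
  is "\<lambda>c f \<omega>. c * f \<omega>" by auto

lemma vector_space_ft: "vector_space (*\<^sub>F)"
  by standard (transfer; simp add: algebra_simps)+

definition conj_linear_on :: "ft_class set \<Rightarrow> (ft_class \<Rightarrow> ft_class) \<Rightarrow> bool" where
  "conj_linear_on V T \<longleftrightarrow>
     (\<forall>x\<in>V. \<forall>y\<in>V. T (x + y) = T x + T y) \<and> (\<forall>c. \<forall>x\<in>V. T (c *\<^sub>F x) = cnj c *\<^sub>F T x)"

subsection \<open>The two Hilbert spaces\<close>

definition H_cdf :: "real \<Rightarrow> ft_class set" where
  "H_cdf \<epsilon> = {H. (\<integral>\<^sup>+\<omega>. ennreal (\<omega>\<^sup>2 / (\<omega>\<^sup>2 + \<epsilon>) * (cmod (ft H \<omega>))\<^sup>2) \<partial>lborel) < \<infinity>}"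

definition norm_cdf :: "real \<Rightarrow> ft_class \<Rightarrow> real" where
  "norm_cdf \<epsilon> H = sqrt (LINT \<omega>|lborel. \<omega>\<^sup>2 / (\<omega>\<^sup>2 + \<epsilon>) * (cmod (ft H \<omega>))\<^sup>2)"

definition inner_cdf :: "real \<Rightarrow> ft_class \<Rightarrow> ft_class \<Rightarrow> complex" where
  "inner_cdf \<epsilon> H K =
     (CLINT \<omega>|lborel. complex_of_real (\<omega>\<^sup>2 / (\<omega>\<^sup>2 + \<epsilon>)) * ft H \<omega> * cnj (ft K \<omega>))"

definition H_eps :: "real \<Rightarrow> ft_class set" where
  "H_eps \<epsilon> = {f. (\<integral>\<^sup>+\<omega>. ennreal ((cmod (ft f \<omega>))\<^sup>2 / (\<omega>\<^sup>2 + \<epsilon>)) \<partial>lborel) < \<infinity>}"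

definition norm_eps :: "real \<Rightarrow> ft_class \<Rightarrow> real" where
  "norm_eps \<epsilon> f = sqrt (1 / (2 * pi) * (LINT \<omega>|lborel. (cmod (ft f \<omega>))\<^sup>2 / (\<omega>\<^sup>2 + \<epsilon>)))"

definition inner_eps :: "real \<Rightarrow> ft_class \<Rightarrow> ft_class \<Rightarrow> complex" where
  "inner_eps \<epsilon> f g = complex_of_real (1 / (2 * pi)) *
     (CLINT \<omega>|lborel. ft f \<omega> * cnj (ft g \<omega>) / complex_of_real (\<omega>\<^sup>2 + \<epsilon>))"

lemma norm_cdf_inner:
  assumes "\<epsilon> > 0"
  shows "inner_cdf \<epsilon> H H = complex_of_real ((norm_cdf \<epsilon> H)\<^sup>2)"
proof -
  have "(LINT \<omega>|lborel. \<omega>\<^sup>2 / (\<omega>\<^sup>2 + \<epsilon>) * (cmod (ft H \<omega>))\<^sup>2) \<ge> 0"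
    using assms by (intro integral_nonneg_AE) auto
  moreover have "inner_cdf \<epsilon> H H =
      (CLINT \<omega>|lborel. complex_of_real (\<omega>\<^sup>2 / (\<omega>\<^sup>2 + \<epsilon>) * (cmod (ft H \<omega>))\<^sup>2))"
    unfolding inner_cdf_def
    by (intro Bochner_Integration.integral_cong)
       (simp_all only: mult.assoc complex_norm_square of_real_mult)
  ultimately show ?thesis
    by (simp add: norm_cdf_def del: of_real_mult of_real_divide of_real_power)
qed

lemma norm_eps_inner:
  assumes "\<epsilon> > 0"
  shows "inner_eps \<epsilon> f f = complex_of_real ((norm_eps \<epsilon> f)\<^sup>2)"
proof -
  have "(LINT \<omega>|lborel. (cmod (ft f \<omega>))\<^sup>2 / (\<omega>\<^sup>2 + \<epsilon>)) \<ge> 0"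
    using assms by (intro integral_nonneg_AE) (auto intro!: divide_nonneg_nonneg add_nonneg_nonneg)
  then have "(norm_eps \<epsilon> f)\<^sup>2 = 1 / (2 * pi) * (LINT \<omega>|lborel. (cmod (ft f \<omega>))\<^sup>2 / (\<omega>\<^sup>2 + \<epsilon>))"
    by (simp add: norm_eps_def)
  moreover have "(CLINT \<omega>|lborel. ft f \<omega> * cnj (ft f \<omega>) / complex_of_real (\<omega>\<^sup>2 + \<epsilon>)) =
      (CLINT \<omega>|lborel. complex_of_real ((cmod (ft f \<omega>))\<^sup>2 / (\<omega>\<^sup>2 + \<epsilon>)))"
    by (intro Bochner_Integration.integral_cong)
       (simp_all only: complex_norm_square of_real_divide)
  ultimately show ?thesis
    by (simp only: inner_eps_def integral_complex_of_real of_real_mult)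
qed

lemma weighted_L2_subspace:
  fixes w :: "real \<Rightarrow> real"
  assumes [measurable]: "w \<in> borel_measurable lborel" and w: "\<And>\<omega>. w \<omega> \<ge> 0"
  shows "module.subspace (*\<^sub>F)
    {H. (\<integral>\<^sup>+\<omega>. ennreal (w \<omega> * (cmod (ft H \<omega>))\<^sup>2) \<partial>lborel) < \<infinity>}"
proof -
  interpret vector_space "(*\<^sub>F)" by (rule vector_space_ft)
  have z: "AE \<omega> in lborel. ft 0 \<omega> = 0"
    unfolding zero_ft_class_def by (rule ft_of_ft) simp
  have p: "AE \<omega> in lborel. ft (H + K) \<omega> = ft H \<omega> + ft K \<omega>" for H K
    using ft_of_ft[of "\<lambda>\<omega>. ft H \<omega> + ft K \<omega>"] by (simp add: plus_ft_class_def)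
  have s: "AE \<omega> in lborel. ft (c *\<^sub>F H) \<omega> = c * ft H \<omega>" for c H
    using ft_of_ft[of "\<lambda>\<omega>. c * ft H \<omega>"] by (simp add: scale_ft_def)
  show ?thesis
  proof (rule subspaceI; clarsimp)
    have "(\<integral>\<^sup>+\<omega>. ennreal (w \<omega> * (cmod (ft 0 \<omega>))\<^sup>2) \<partial>lborel) = (\<integral>\<^sup>+\<omega>. 0 \<partial>(lborel :: real measure))"
      using z by (intro nn_integral_cong_AE) auto
    then show "(\<integral>\<^sup>+\<omega>. ennreal (w \<omega> * (cmod (ft 0 \<omega>))\<^sup>2) \<partial>lborel) < top" by simp
  next
    fix H K
    assume H: "(\<integral>\<^sup>+\<omega>. ennreal (w \<omega> * (cmod (ft H \<omega>))\<^sup>2) \<partial>lborel) < top"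
      and K: "(\<integral>\<^sup>+\<omega>. ennreal (w \<omega> * (cmod (ft K \<omega>))\<^sup>2) \<partial>lborel) < top"
    have *: "(cmod (a + b))\<^sup>2 \<le> 2 * (cmod a)\<^sup>2 + 2 * (cmod b)\<^sup>2" for a b
    proof -
      have "(cmod (a + b))\<^sup>2 \<le> (cmod a + cmod b)\<^sup>2"
        by (intro power_mono norm_triangle_ineq) auto
      also have "\<dots> \<le> 2 * (cmod a)\<^sup>2 + 2 * (cmod b)\<^sup>2"
        using sum_squares_ge_zero[of "cmod a - cmod b" 0] by (simp add: power2_eq_square algebra_simps)
      finally show ?thesis .
    qed
    have "(\<integral>\<^sup>+\<omega>. ennreal (w \<omega> * (cmod (ft (H + K) \<omega>))\<^sup>2) \<partial>lborel) \<le>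
      (\<integral>\<^sup>+\<omega>. 2 * ennreal (w \<omega> * (cmod (ft H \<omega>))\<^sup>2) + 2 * ennreal (w \<omega> * (cmod (ft K \<omega>))\<^sup>2) \<partial>lborel)"
    proof (rule nn_integral_mono_AE)
      show "AE \<omega> in lborel. ennreal (w \<omega> * (cmod (ft (H + K) \<omega>))\<^sup>2) \<le>
        2 * ennreal (w \<omega> * (cmod (ft H \<omega>))\<^sup>2) + 2 * ennreal (w \<omega> * (cmod (ft K \<omega>))\<^sup>2)"
        using p[of H K]
      proof eventually_elim
        case (elim \<omega>)
        have "w \<omega> * (cmod (ft (H + K) \<omega>))\<^sup>2 \<le>
            2 * (w \<omega> * (cmod (ft H \<omega>))\<^sup>2) + 2 * (w \<omega> * (cmod (ft K \<omega>))\<^sup>2)"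
          using mult_left_mono[OF *[of "ft H \<omega>" "ft K \<omega>"] w[of \<omega>]] elim by (simp add: algebra_simps)
        then have "ennreal (w \<omega> * (cmod (ft (H + K) \<omega>))\<^sup>2) \<le>
            ennreal (2 * (w \<omega> * (cmod (ft H \<omega>))\<^sup>2) + 2 * (w \<omega> * (cmod (ft K \<omega>))\<^sup>2))"
          by (rule ennreal_leI)
        also have "\<dots> = 2 * ennreal (w \<omega> * (cmod (ft H \<omega>))\<^sup>2) + 2 * ennreal (w \<omega> * (cmod (ft K \<omega>))\<^sup>2)"
          using w[of \<omega>] by (simp add: ennreal_plus ennreal_mult)
        finally show ?case .
      qed
    qed
    also have "\<dots> < top"
      using H K by (simp add: nn_integral_add nn_integral_cmult ennreal_mult_less_top)
    finally show "(\<integral>\<^sup>+\<omega>. ennreal (w \<omega> * (cmod (ft (H + K) \<omega>))\<^sup>2) \<partial>lborel) < top" .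
  next
    fix c H
    assume H: "(\<integral>\<^sup>+\<omega>. ennreal (w \<omega> * (cmod (ft H \<omega>))\<^sup>2) \<partial>lborel) < top"
    have "(\<integral>\<^sup>+\<omega>. ennreal (w \<omega> * (cmod (ft (c *\<^sub>F H) \<omega>))\<^sup>2) \<partial>lborel) =
      (\<integral>\<^sup>+\<omega>. ennreal ((cmod c)\<^sup>2) * ennreal (w \<omega> * (cmod (ft H \<omega>))\<^sup>2) \<partial>lborel)"
    proof (rule nn_integral_cong_AE)
      show "AE \<omega> in lborel. ennreal (w \<omega> * (cmod (ft (c *\<^sub>F H) \<omega>))\<^sup>2) =
        ennreal ((cmod c)\<^sup>2) * ennreal (w \<omega> * (cmod (ft H \<omega>))\<^sup>2)"
        using s[of c H]
      proof eventually_elim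
        case (elim \<omega>)
        then show ?case using w[of \<omega>]
          by (simp add: norm_mult power_mult_distrib ennreal_mult'[symmetric] ac_simps)
      qed
    qed
    also have "\<dots> < top"
      using H by (simp add: nn_integral_cmult ennreal_mult_less_top)
    finally show "(\<integral>\<^sup>+\<omega>. ennreal (w \<omega> * (cmod (ft (c *\<^sub>F H) \<omega>))\<^sup>2) \<partial>lborel) < top" .
  qed
qed

lemma subspace_H_cdf: "\<epsilon> > 0 \<Longrightarrow> module.subspace (*\<^sub>F) (H_cdf \<epsilon>)"
  unfolding H_cdf_def by (rule weighted_L2_subspace) auto

lemma subspace_H_eps: "\<epsilon> > 0 \<Longrightarrow> module.subspace (*\<^sub>F) (H_eps \<epsilon>)"
  using weighted_L2_subspace[of "\<lambda>\<omega>. 1 / (\<omega>\<^sup>2 + \<epsilon>)"] by (simp add: H_eps_def add_nonneg_nonneg)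

subsection \<open>Square-integrable functions as elements\<close>

definition square_integrable :: "(real \<Rightarrow> complex) \<Rightarrow> bool" where
  "square_integrable f \<longleftrightarrow>
     f \<in> borel_measurable lborel \<and> integrable lborel (\<lambda>x. (cmod (f x))\<^sup>2)"

definition truncated_fourier :: "real \<Rightarrow> (real \<Rightarrow> complex) \<Rightarrow> real \<Rightarrow> complex" where
  "truncated_fourier R f \<omega> =
     complex_of_real (1 / sqrt (2 * pi)) * (CLINT x:{-R..R}|lborel. f x * iexp (- (\<omega> * x)))"

text \<open>The Fourier--Plancherel transform of a square-integrable \<open>f\<close> (which need not be integrable)
  is the limit in \<open>L\<^sup>2\<close> of the transforms of its truncations to \<open>[-R, R]\<close>; \<open>L2_elem f\<close> is the
  element with this transform. The limit is unique modulo a.e. equality.\<close>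

definition L2_elem :: "(real \<Rightarrow> complex) \<Rightarrow> ft_class" where
  "L2_elem f = (THE H. square_integrable (ft H) \<and>
     ((\<lambda>R. \<integral>\<^sup>+\<omega>. ennreal ((cmod (truncated_fourier R f \<omega> - ft H \<omega>))\<^sup>2) \<partial>lborel) \<longlongrightarrow> 0) at_top)"

lemma L2_elem_eqI:
  assumes [measurable]: "f \<in> borel_measurable lborel"
    and H: "square_integrable (ft H)"
      "((\<lambda>R. \<integral>\<^sup>+\<omega>. ennreal ((cmod (truncated_fourier R f \<omega> - ft H \<omega>))\<^sup>2) \<partial>lborel) \<longlongrightarrow> 0) at_top"
  shows "L2_elem f = H"
  unfolding L2_elem_def
proof (rule the_equality)
  let ?d = "\<lambda>K R. \<integral>\<^sup>+\<omega>. ennreal ((cmod (truncated_fourier R f \<omega> - ft K \<omega>))\<^sup>2) \<partial>lborel"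
  have [measurable]: "truncated_fourier R f \<in> borel_measurable lborel" for R
    unfolding truncated_fourier_def set_lebesgue_integral_def by measurable
  fix K
  assume K: "square_integrable (ft K) \<and> (?d K \<longlongrightarrow> 0) at_top"
  let ?I = "\<integral>\<^sup>+\<omega>. ennreal ((cmod (ft H \<omega> - ft K \<omega>))\<^sup>2) \<partial>lborel"
  have *: "(cmod (a - b))\<^sup>2 \<le> 2 * (cmod (t - a))\<^sup>2 + 2 * (cmod (t - b))\<^sup>2" for a b t
  proof -
    have "(cmod (a - b))\<^sup>2 \<le> (cmod (t - a) + cmod (t - b))\<^sup>2"
      using norm_triangle_ineq4[of "t - b" "t - a"] by (intro power_mono) auto
    also have "\<dots> \<le> 2 * (cmod (t - a))\<^sup>2 + 2 * (cmod (t - b))\<^sup>2"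
      using sum_squares_ge_zero[of "cmod (t - a) - cmod (t - b)" 0]
      by (simp add: power2_eq_square algebra_simps)
    finally show ?thesis .
  qed
  have le: "?I \<le> 2 * ?d H R + 2 * ?d K R" for R
  proof -
    have "?I \<le> (\<integral>\<^sup>+\<omega>. 2 * ennreal ((cmod (truncated_fourier R f \<omega> - ft H \<omega>))\<^sup>2)
                 + 2 * ennreal ((cmod (truncated_fourier R f \<omega> - ft K \<omega>))\<^sup>2) \<partial>lborel)"
    proof (rule nn_integral_mono)
      fix \<omega>
      show "ennreal ((cmod (ft H \<omega> - ft K \<omega>))\<^sup>2)
          \<le> 2 * ennreal ((cmod (truncated_fourier R f \<omega> - ft H \<omega>))\<^sup>2)
            + 2 * ennreal ((cmod (truncated_fourier R f \<omega> - ft K \<omega>))\<^sup>2)"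
        using ennreal_leI[OF *[of "ft H \<omega>" "ft K \<omega>" "truncated_fourier R f \<omega>"]]
        by (simp add: ennreal_plus ennreal_mult)
    qed
    also have "\<dots> = 2 * ?d H R + 2 * ?d K R"
      by (simp add: nn_integral_add nn_integral_cmult)
    finally show ?thesis .
  qed
  have "((\<lambda>R. 2 * ?d H R + 2 * ?d K R) \<longlongrightarrow> 2 * 0 + 2 * 0) at_top"
    using H K by (intro tendsto_add ennreal_tendsto_cmult) auto
  from tendsto_lowerbound[OF this always_eventually, of ?I] have "?I = 0"
    using le by simp
  then have "AE \<omega> in lborel. ennreal ((cmod (ft H \<omega> - ft K \<omega>))\<^sup>2) = 0"
    by (subst (asm) nn_integral_0_iff_AE) auto
  then have "AE \<omega> in lborel. ft K \<omega> = ft H \<omega>"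
    by eventually_elim auto
  then show "K = H"
    by (simp add: ft_class_eq_iff)
qed (use H in simp)

subsection \<open>Distribution functions, the embedding of laws, and the map between the spaces\<close>

definition Gamma_F :: "(real \<Rightarrow> real) set" where
  "Gamma_F = {F. (\<exists>P. real_distribution P \<and> F = cdf P) \<and>
                 square_integrable (\<lambda>x. complex_of_real (F x - indicator {0..} x))}"

definition Phi :: "real measure \<Rightarrow> ft_class" where
  "Phi P = of_ft (\<lambda>\<omega>. char P \<omega> - 1)"

definition U_map :: "ft_class \<Rightarrow> ft_class" where
  "U_map H = of_ft (\<lambda>\<omega>. - complex_of_real (sqrt (2 * pi)) * \<i> * complex_of_real \<omega> * cnj (ft H \<omega>))"

lemma ft_U_map:
  "AE \<omega> in lborel. ft (U_map H) \<omega> =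
     - complex_of_real (sqrt (2 * pi)) * \<i> * complex_of_real \<omega> * cnj (ft H \<omega>)"
  unfolding U_map_def
proof (rule ft_of_ft)
  have "(\<lambda>\<omega>. cnj (ft H \<omega>)) \<in> borel_measurable lborel"
    by (rule measurable_compose[OF ft_measurable])
       (intro borel_measurable_continuous_onI continuous_intros)
  then show "(\<lambda>\<omega>. - complex_of_real (sqrt (2 * pi)) * \<i> * complex_of_real \<omega> * cnj (ft H \<omega>))
      \<in> borel_measurable lborel"
    by measurable
qed

lemma ft_Phi:
  assumes "real_distribution P"
  shows "AE \<omega> in lborel. ft (Phi P) \<omega> = char P \<omega> - 1"
  unfolding Phi_def
  using real_distribution.char_measurable[OF assms] by (intro ft_of_ft) simp

end

theory Submission
  imports Defs
begin

text \<open>On Fourier transforms, \<open>U_map\<close> conjugates and multiplies by a function that vanishes only at 0 and turns one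
  weight into the other, so everything but \<open>U_map (F1 - F2) = Phi P1 - Phi P2\<close> is pointwise. For the
  latter the Fourier--Plancherel transform of \<open>F = F1 - F2\<close>, which need not be integrable, has to be
  found. By Fubini, the transform of \<open>F\<close> truncated to \<open>[-R, R]\<close> is, up to a factor proportional to
  \<open>1 / \<omega>\<close>, the difference of the conjugate characteristic functions of the two laws clamped to \<open>[-R, R]\<close>,
  which converges pointwise. Half of Plancherel's theorem, the \<open>L\<^sup>2\<close> bound for integrable functions,
  makes the truncated transforms Cauchy in \<open>L\<^sup>2\<close>, and Fatou's lemma identifies their \<open>L\<^sup>2\<close> limit with
  the pointwise one. The \<open>L\<^sup>2\<close> bound follows by averaging the squared transform over a
  Gaussian frequency, whose characteristic function is known, and letting the variance grow.\<close>

text \<open>Fatou's lemma, with an almost everywhere limit in place of the limit inferior. It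
  carries both passages to the limit below: the growing Gaussian variance and the growing truncation
  radius.\<close>

lemma nn_integral_le_of_tendsto:
  fixes u :: "nat \<Rightarrow> 'a \<Rightarrow> ennreal"
  assumes u: "\<And>n. u n \<in> borel_measurable M"
    and lim: "AE x in M. (\<lambda>n. u n x) \<longlonglongrightarrow> v x"
    and bound: "\<And>n. (\<integral>\<^sup>+x. u n x \<partial>M) \<le> C"
  shows "(\<integral>\<^sup>+x. v x \<partial>M) \<le> C"
proof -
  have "(\<integral>\<^sup>+x. v x \<partial>M) = (\<integral>\<^sup>+x. liminf (\<lambda>n. u n x) \<partial>M)"
    using lim by (intro nn_integral_cong_AE, eventually_elim) (simp add: lim_imp_Liminf)
  also have "\<dots> \<le> liminf (\<lambda>n. \<integral>\<^sup>+x. u n x \<partial>M)"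
    by (rule nn_integral_liminf[OF u])
  also have "\<dots> \<le> C"
    using bound by (intro Liminf_le) auto
  finally show ?thesis .
qed

section \<open>The L2 bound for Fourier integrals of integrable functions\<close>

definition fourier_int :: "(real \<Rightarrow> complex) \<Rightarrow> real \<Rightarrow> complex" where
  "fourier_int h \<omega> = (CLINT x|lborel. h x * iexp (- (\<omega> * x)))"

lemma fourier_int_measurable [measurable]:
  assumes [measurable]: "h \<in> borel_measurable lborel"
  shows "fourier_int h \<in> borel_measurable lborel"
  unfolding fourier_int_def by measurable

lemma integrable_times_iexp:
  assumes "integrable M h" and [measurable]: "g \<in> borel_measurable M"
  shows "integrable M (\<lambda>x. h x * iexp (g x))"
  by (rule Bochner_Integration.integrable_bound[OF assms(1)])
     (use assms in \<open>auto simp: norm_mult\<close>)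

lemma cnj_measurable: "cnj \<in> borel_measurable borel"
  by (intro borel_measurable_continuous_onI continuous_intros)

lemma nn_integral_gauss:
  assumes "s > 0"
  shows "(\<integral>\<^sup>+y. ennreal (exp (- (s * (y - x))\<^sup>2 / 2)) \<partial>lborel) = ennreal (sqrt (2 * pi) / s)"
proof -
  have "(\<integral>\<^sup>+y. ennreal (exp (- (s * (y - x))\<^sup>2 / 2)) \<partial>lborel)
      = (\<integral>\<^sup>+y. ennreal (sqrt (2 * pi) / s) * ennreal (normal_density x (1 / s) y) \<partial>lborel)"
  proof (rule nn_integral_cong)
    fix y
    have "exp (- (s * (y - x))\<^sup>2 / 2) = sqrt (2 * pi) / s * normal_density x (1 / s) y"
      using assms by (simp add: normal_density_def real_sqrt_mult real_sqrt_divide field_simps power2_eq_square)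
    then show "ennreal (exp (- (s * (y - x))\<^sup>2 / 2))
        = ennreal (sqrt (2 * pi) / s) * ennreal (normal_density x (1 / s) y)"
      using assms by (simp add: ennreal_mult'[symmetric])
  qed
  also have "\<dots> = ennreal (sqrt (2 * pi) / s)"
    using assms by (simp add: nn_integral_cmult nn_integral_eq_integral)
  finally show ?thesis .
qed

text \<open>The squared modulus is a double integral of \<open>h x * cnj (h y)\<close> against an
  oscillating factor. Averaging that factor over a standard normal \<open>z\<close> gives the
  characteristic function of the normal law, hence the positive kernel \<open>g\<close>. All
  sections of \<open>g\<close> have the same mass, so a Schur-type estimate bounds the double
  integral by the L2 norm of \<open>h\<close>.\<close>

lemma gauss_mean_fourier:
  assumes h: "integrable lborel h" and s: "s > 0"
  shows "(\<integral>\<^sup>+z. ennreal ((cmod (fourier_int h (s * z)))\<^sup>2) \<partial>std_normal_distribution)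
    \<le> ennreal (sqrt (2 * pi) / s) * (\<integral>\<^sup>+x. ennreal ((cmod (h x))\<^sup>2) \<partial>lborel)"
proof -
  let ?N = "std_normal_distribution"
  let ?L = "lborel \<Otimes>\<^sub>M (lborel :: real measure)"
  define g where "g p = exp (- (s * (snd p - fst p))\<^sup>2 / 2)" for p :: "real \<times> real"
  define k where "k p = h (fst p) * cnj (h (snd p))" for p
  note [measurable] = borel_measurable_integrable[OF h] cnj_measurable
  interpret N: real_distribution ?N by (rule real_dist_normal_dist)
  interpret L: sigma_finite_measure ?L unfolding lborel_prod by (rule sigma_finite_lborel)
  interpret NL: pair_sigma_finite ?N ?L ..
  have hc: "integrable lborel (\<lambda>y. cnj (h y))"
    using h by (rule integrable_cnj)
  have k: "integrable ?L k"
  proof (rule lborel_pair.Fubini_integrable)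
    show "k \<in> borel_measurable ?L" unfolding k_def by measurable
    have "integrable lborel (\<lambda>x. cmod (h x) * (LINT y|lborel. cmod (h y)))"
      using h by auto
    then show "integrable lborel (\<lambda>x. LINT y|lborel. norm (k (x, y)))"
      by (simp add: k_def norm_mult)
    show "AE x in lborel. integrable lborel (\<lambda>y. k (x, y))"
      using hc by (auto simp: k_def)
  qed
  have [measurable]: "k \<in> borel_measurable ?L" "g \<in> borel_measurable ?L"
    unfolding k_def g_def by measurable
  have gx: "(\<integral>\<^sup>+y. ennreal (g (x, y)) \<partial>lborel) = ennreal (sqrt (2 * pi) / s)" for x
    by (simp only: g_def fst_conv snd_conv nn_integral_gauss[OF s])
  have gy: "(\<integral>\<^sup>+x. ennreal (g (x, y)) \<partial>lborel) = ennreal (sqrt (2 * pi) / s)" for y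
  proof -
    have "g (x, y) = g (y, x)" for x
      by (simp add: g_def power_mult_distrib power2_commute)
    then show ?thesis by (simp only: gx)
  qed
  \<comment> \<open>The product of the transform with its conjugate becomes one integral over pairs,
    in which the frequency occurs only in the exponential.\<close>
  have sq: "complex_of_real ((cmod (fourier_int h \<omega>))\<^sup>2)
      = (CLINT p|?L. k p * iexp (\<omega> * (snd p - fst p)))" for \<omega>
  proof -
    have "integrable ?L (\<lambda>p. k p * iexp (\<omega> * (snd p - fst p)))"
      by (intro integrable_times_iexp k) measurable
    then have "(CLINT p|?L. k p * iexp (\<omega> * (snd p - fst p)))
        = (CLINT x|lborel. CLINT y|lborel. h x * cnj (h y) * iexp (\<omega> * (y - x)))"
      by (subst lborel_pair.integral_fst'[symmetric]) (auto simp: k_def)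
    also have "\<dots> = (CLINT x|lborel. CLINT y|lborel.
        (h x * iexp (- (\<omega> * x))) * cnj (h y * iexp (- (\<omega> * y))))"
    proof (intro Bochner_Integration.integral_cong refl)
      fix x y
      have "iexp (\<omega> * (y - x)) = iexp (- (\<omega> * x)) * cnj (iexp (- (\<omega> * y)))"
        by (simp add: exp_cnj algebra_simps flip: exp_add)
      then show "h x * cnj (h y) * iexp (\<omega> * (y - x))
          = (h x * iexp (- (\<omega> * x))) * cnj (h y * iexp (- (\<omega> * y)))"
        by simp
    qed
    also have "\<dots> = fourier_int h \<omega> * cnj (fourier_int h \<omega>)"
      by (simp add: fourier_int_def del: complex_cnj_mult)
    also have "\<dots> = complex_of_real ((cmod (fourier_int h \<omega>))\<^sup>2)"
      by (simp only: complex_norm_square)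
    finally show ?thesis by simp
  qed
  \<comment> \<open>The modulus of the integrand is \<open>norm (k p)\<close> whatever
    \<open>z\<close> is, so its integral over \<open>?L\<close> is constant in \<open>z\<close>, and
    constants are integrable over a probability measure.\<close>
  have NL: "integrable (?N \<Otimes>\<^sub>M ?L) (\<lambda>(z, p). k p * iexp (s * z * (snd p - fst p)))"
  proof (rule NL.Fubini_integrable)
    show "(\<lambda>(z, p). k p * iexp (s * z * (snd p - fst p))) \<in> borel_measurable (?N \<Otimes>\<^sub>M ?L)"
      by measurable
    show "AE z in ?N. integrable ?L (\<lambda>p. case (z, p) of (z, p) \<Rightarrow> k p * iexp (s * z * (snd p - fst p)))"
      unfolding prod.case by (intro AE_I2 integrable_times_iexp k) measurable
  qed (simp add: norm_mult)
  have int_sq: "integrable ?N (\<lambda>z. (cmod (fourier_int h (s * z)))\<^sup>2)"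
  proof -
    have "integrable ?N (\<lambda>z. complex_of_real ((cmod (fourier_int h (s * z)))\<^sup>2))"
      using NL.integrable_fst'[OF NL] by (simp only: sq prod.case)
    from integrable_Re[OF this] show ?thesis by simp
  qed
  have "complex_of_real (LINT z|?N. (cmod (fourier_int h (s * z)))\<^sup>2)
      = (CLINT z|?N. CLINT p|?L. k p * iexp (s * z * (snd p - fst p)))"
    by (simp only: integral_complex_of_real[symmetric] sq)
  also have "\<dots> = (CLINT p|?L. CLINT z|?N. k p * iexp (s * z * (snd p - fst p)))"
    using NL.Fubini_integral[of "\<lambda>z p. k p * iexp (s * z * (snd p - fst p))"] NL by simp
  also have "\<dots> = (CLINT p|?L. k p * char ?N (s * (snd p - fst p)))"
    unfolding char_def by (simp add: mult_ac)
  also have "\<dots> = (CLINT p|?L. k p * complex_of_real (g p))"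
    by (simp add: char_std_normal_distribution g_def)
  finally have eq: "complex_of_real (LINT z|?N. (cmod (fourier_int h (s * z)))\<^sup>2)
      = (CLINT p|?L. k p * complex_of_real (g p))" .
  have kg: "integrable ?L (\<lambda>p. k p * complex_of_real (g p))"
    by (rule Bochner_Integration.integrable_bound[OF k]) 
       (auto simp: norm_mult g_def intro!: AE_I2 mult_left_le)
  have "(\<integral>\<^sup>+z. ennreal ((cmod (fourier_int h (s * z)))\<^sup>2) \<partial>?N)
      = ennreal (LINT z|?N. (cmod (fourier_int h (s * z)))\<^sup>2)"
    by (rule nn_integral_eq_integral[OF int_sq]) auto
  \<comment> \<open>The mean is nonnegative, so it equals the norm of its complex form, and the
    triangle inequality for integrals applies to the complex double integral.\<close>
  also have "\<dots> = ennreal (norm (complex_of_real (LINT z|?N. (cmod (fourier_int h (s * z)))\<^sup>2)))"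
    by (simp add: integral_nonneg_AE)
  also have "\<dots> \<le> (\<integral>\<^sup>+p. norm (k p * complex_of_real (g p)) \<partial>?L)"
    unfolding eq by (rule integral_norm_bound_ennreal[OF kg])
  \<comment> \<open>The inequality \<open>2 * a * b \<le> a\<^sup>2 + b\<^sup>2\<close> separates
    the two variables: in each half the variable absent from \<open>h\<close> occurs in
    \<open>g\<close> only and integrates out by \<open>gx\<close> or \<open>gy\<close>.\<close>
  also have "\<dots> \<le> (\<integral>\<^sup>+p. ennreal (1/2) * (ennreal ((cmod (h (fst p)))\<^sup>2) * ennreal (g p))
      + ennreal (1/2) * (ennreal ((cmod (h (snd p)))\<^sup>2) * ennreal (g p)) \<partial>?L)"
  proof (rule nn_integral_mono)
    fix p
    have half_mult: "ennreal (1/2 * (a * b)) = ennreal (1/2) * (ennreal a * ennreal b)" if "a \<ge> 0" for a b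
      using that ennreal_mult'[of "1/2" "a * b"] ennreal_mult'[of a b] by simp
    have "cmod (h (fst p)) * cmod (h (snd p)) \<le> ((cmod (h (fst p)))\<^sup>2 + (cmod (h (snd p)))\<^sup>2) / 2"
      using sum_squares_bound[of "cmod (h (fst p))" "cmod (h (snd p))"] by simp
    then have "norm (k p * complex_of_real (g p))
        \<le> ((cmod (h (fst p)))\<^sup>2 + (cmod (h (snd p)))\<^sup>2) / 2 * g p"
      by (simp add: k_def norm_mult g_def)
    also have "\<dots> = 1/2 * ((cmod (h (fst p)))\<^sup>2 * g p) + 1/2 * ((cmod (h (snd p)))\<^sup>2 * g p)"
      by (simp add: field_simps)
    finally have "ennreal (norm (k p * complex_of_real (g p)))
        \<le> ennreal (1/2 * ((cmod (h (fst p)))\<^sup>2 * g p) + 1/2 * ((cmod (h (snd p)))\<^sup>2 * g p))"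
      by (rule ennreal_leI)
    also have "\<dots> = ennreal (1/2) * (ennreal ((cmod (h (fst p)))\<^sup>2) * ennreal (g p))
      + ennreal (1/2) * (ennreal ((cmod (h (snd p)))\<^sup>2) * ennreal (g p))"
      by (subst ennreal_plus) (auto simp: g_def half_mult simp del: times_divide_eq_left mult_1)
    finally show "ennreal (norm (k p * complex_of_real (g p)))
        \<le> ennreal (1/2) * (ennreal ((cmod (h (fst p)))\<^sup>2) * ennreal (g p))
      + ennreal (1/2) * (ennreal ((cmod (h (snd p)))\<^sup>2) * ennreal (g p))" .
  qed
  also have "\<dots> = ennreal (1/2) * (\<integral>\<^sup>+p. ennreal ((cmod (h (fst p)))\<^sup>2) * ennreal (g p) \<partial>?L)
      + ennreal (1/2) * (\<integral>\<^sup>+p. ennreal ((cmod (h (snd p)))\<^sup>2) * ennreal (g p) \<partial>?L)"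
    by (subst nn_integral_add, measurable) (subst nn_integral_cmult, measurable)+
  also have "(\<integral>\<^sup>+p. ennreal ((cmod (h (fst p)))\<^sup>2) * ennreal (g p) \<partial>?L)
      = (\<integral>\<^sup>+x. ennreal ((cmod (h x))\<^sup>2) * ennreal (sqrt (2 * pi) / s) \<partial>lborel)"
    by (subst lborel.nn_integral_fst[symmetric], measurable) (simp add: nn_integral_cmult gx)
  also have "(\<integral>\<^sup>+p. ennreal ((cmod (h (snd p)))\<^sup>2) * ennreal (g p) \<partial>?L)
      = (\<integral>\<^sup>+x. ennreal ((cmod (h x))\<^sup>2) * ennreal (sqrt (2 * pi) / s) \<partial>lborel)"
    by (subst lborel_pair.nn_integral_snd[symmetric], measurable) (simp add: nn_integral_cmult gy)
  also have "ennreal (1/2) * X + ennreal (1/2) * X = X" for X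
    by (simp add: distrib_right[symmetric] ennreal_plus[symmetric] del: ennreal_plus ennreal_half)
  finally show ?thesis
    by (simp add: nn_integral_multc mult.commute)
qed

text \<open>The Gaussian weights in \<open>u n\<close> tend to 1 pointwise, so it suffices to bound
  the weighted integrals uniformly in \<open>n\<close>. Rescaling to a standard normal frequency
  costs a factor \<open>?s\<close>, which the factor \<open>1 / ?s\<close> of the averaged bound
  absorbs. The constant is 2 pi because \<open>fourier_int\<close> is not normalised.\<close>

lemma fourier_int_L2_bound:
  assumes h: "integrable lborel h"
  shows "(\<integral>\<^sup>+\<omega>. ennreal ((cmod (fourier_int h \<omega>))\<^sup>2) \<partial>lborel)
    \<le> ennreal (2 * pi) * (\<integral>\<^sup>+x. ennreal ((cmod (h x))\<^sup>2) \<partial>lborel)" (is "_ \<le> ?C")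
proof (rule nn_integral_le_of_tendsto)
  note [measurable] = borel_measurable_integrable[OF h]
  define u where "u n \<omega> = ennreal ((cmod (fourier_int h \<omega>))\<^sup>2 * exp (- (\<omega> / Suc n)\<^sup>2 / 2))" for n \<omega>
  have u [measurable]: "u n \<in> borel_measurable lborel" for n
    unfolding u_def by measurable
  show "u n \<in> borel_measurable lborel" for n
    by (rule u)
  show "AE \<omega> in lborel. (\<lambda>n. u n \<omega>) \<longlonglongrightarrow> ennreal ((cmod (fourier_int h \<omega>))\<^sup>2)"
  proof (rule AE_I2)
    fix \<omega>
    have "(\<lambda>n. \<omega> / real (Suc n)) \<longlonglongrightarrow> 0"
      by (rule LIMSEQ_Suc[OF lim_const_over_n])
    then have "(\<lambda>n. (cmod (fourier_int h \<omega>))\<^sup>2 * exp (- (\<omega> / Suc n)\<^sup>2 / 2))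
        \<longlonglongrightarrow> (cmod (fourier_int h \<omega>))\<^sup>2 * exp (- 0\<^sup>2 / 2)"
      by (intro tendsto_intros) auto
    then show "(\<lambda>n. u n \<omega>) \<longlonglongrightarrow> ennreal ((cmod (fourier_int h \<omega>))\<^sup>2)"
      unfolding u_def by (intro tendsto_ennrealI) simp
  qed
  have assoc: "ennreal a * (ennreal b * (ennreal c * X)) = ennreal (a * (b * c)) * X"
    if "a \<ge> 0" "b \<ge> 0" "c \<ge> 0" for a b c X
    using that by (simp add: ennreal_mult mult.assoc)
  fix n
  let ?s = "real (Suc n)"
  \<comment> \<open>Substituting \<open>?s * z\<close> for \<omega> turns the Gaussian weight into
    \<open>sqrt (2 * pi)\<close> times the standard normal density.\<close>
  have "(\<integral>\<^sup>+\<omega>. u n \<omega> \<partial>lborel) = ennreal ?s * (\<integral>\<^sup>+z. u n (?s * z) \<partial>lborel)"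
    using nn_integral_real_affine[of "u n" ?s 0] u[of n] by (simp del: of_nat_Suc)
  also have "(\<integral>\<^sup>+z. u n (?s * z) \<partial>lborel) =
      (\<integral>\<^sup>+z. ennreal (sqrt (2 * pi)) * (ennreal (std_normal_density z) * ennreal ((cmod (fourier_int h (?s * z)))\<^sup>2)) \<partial>lborel)"
    by (intro nn_integral_cong)
       (simp add: u_def std_normal_density_def ennreal_mult'[symmetric] mult_ac del: of_nat_Suc)
  also have "\<dots> = ennreal (sqrt (2 * pi)) * (\<integral>\<^sup>+z. ennreal ((cmod (fourier_int h (?s * z)))\<^sup>2) \<partial>std_normal_distribution)"
    by (simp add: nn_integral_cmult nn_integral_density)
  also have "ennreal ?s * \<dots> \<le> ennreal ?s * (ennreal (sqrt (2 * pi)) *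
      (ennreal (sqrt (2 * pi) / ?s) * (\<integral>\<^sup>+x. ennreal ((cmod (h x))\<^sup>2) \<partial>lborel)))"
    by (intro mult_left_mono gauss_mean_fourier h) auto
  also have "\<dots> = ennreal (?s * (sqrt (2 * pi) * (sqrt (2 * pi) / ?s))) * (\<integral>\<^sup>+x. ennreal ((cmod (h x))\<^sup>2) \<partial>lborel)"
    by (rule assoc) auto
  also have "?s * (sqrt (2 * pi) * (sqrt (2 * pi) / ?s)) = 2 * pi"
    by (simp del: of_nat_Suc)
  finally show "(\<integral>\<^sup>+\<omega>. u n \<omega> \<partial>lborel) \<le> ?C" .
qed

section \<open>Fourier integrals of truncated distribution functions\<close>

lemma integrable_indicator_Icc: "integrable lborel (indicator {a..b} :: real \<Rightarrow> real)"
  by (intro integrable_real_indicator) (auto simp: emeasure_lborel_Icc_eq)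

text \<open>The fundamental theorem of calculus. Keeping the factor \<open>\<i> * \<omega>\<close>
  on the left instead of dividing by it covers \<omega> = 0 as well.\<close>

lemma iexp_times_integral_Icc:
  assumes "a \<le> b"
  shows "\<i> * complex_of_real \<omega> * (CLINT x|lborel. indicator {a..b} x *\<^sub>R iexp (- (\<omega> * x)))
    = iexp (- (\<omega> * a)) - iexp (- (\<omega> * b))"
proof -
  have "(CLINT x|lborel. indicator {a..b} x *\<^sub>R (- (\<i> * complex_of_real \<omega>) * iexp (- (\<omega> * x))))
      = iexp (- (\<omega> * b)) - iexp (- (\<omega> * a))"
  proof (rule integral_FTC_atLeastAtMost[OF assms])
    fix x
    have "((\<lambda>x. exp (- (\<i> * of_real \<omega>) * of_real x)) has_vector_derivative
        exp (- (\<i> * of_real \<omega>) * of_real x) * - (\<i> * complex_of_real \<omega>)) (at x within {a..b})"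
      by (rule has_vector_derivative_real_field) (auto intro!: derivative_eq_intros)
    then show "((\<lambda>x. iexp (- (\<omega> * x))) has_vector_derivative
        - (\<i> * complex_of_real \<omega>) * iexp (- (\<omega> * x))) (at x within {a..b})"
      by (simp add: mult_ac)
  qed (intro continuous_intros)
  moreover have "(CLINT x|lborel. indicator {a..b} x *\<^sub>R (- (\<i> * complex_of_real \<omega>) * iexp (- (\<omega> * x))))
      = - (\<i> * complex_of_real \<omega>) * (CLINT x|lborel. indicator {a..b} x *\<^sub>R iexp (- (\<omega> * x)))"
    by (simp only: mult_scaleR_right[symmetric] integral_mult_right_zero)
  ultimately show ?thesis
    by (simp add: algebra_simps)
qed

context real_distribution
begin

lemma cdf_borel_measurable [measurable]: "cdf M \<in> borel_measurable borel"
  by (intro borel_measurable_mono monoI cdf_nondecreasing)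

lemma cdf_eq_integral: "cdf M x = (LINT y|M. indicator {..x} y)"
  by (simp add: cdf_def)

text \<open>Write the distribution function as an integral of indicators and integrate over
  \<open>x\<close> first, by Fubini. For fixed \<open>y\<close> the range of \<open>x\<close> is the
  interval from \<open>y\<close> clamped to [-R, R] up to \<open>R\<close>, so only two boundary
  terms remain. The one at \<open>R\<close> is the same for all laws and cancels in
  differences.\<close>

lemma fourier_truncated_cdf:
  assumes "R \<ge> 0"
  shows "\<i> * complex_of_real \<omega> * (CLINT x|lborel. indicator {-R..R} x *\<^sub>R (complex_of_real (cdf M x) * iexp (- (\<omega> * x))))
    = (CLINT y|M. iexp (- (\<omega> * max (-R) (min R y)))) - iexp (- (\<omega> * R))"
proof -
  interpret PL: pair_sigma_finite M "lborel :: real measure" ..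
  let ?k = "\<lambda>y x. indicator {-R..R} x *\<^sub>R (complex_of_real (indicator {..x} y) * iexp (- (\<omega> * x)))"
  have icc: "integrable lborel (indicator {-R..R} :: real \<Rightarrow> real)"
    by (rule integrable_indicator_Icc)
  have meas [measurable]: "case_prod ?k \<in> borel_measurable (M \<Otimes>\<^sub>M lborel)"
  proof -
    \<comment> \<open>Joint measurability: the indicator of the moving half-line is that of the
      half-plane below the diagonal.\<close>
    have "(\<lambda>p. indicator {..snd p} (fst p) :: real) = (\<lambda>p. if fst p \<le> snd p then 1 else 0)"
      by (auto simp: indicator_def fun_eq_iff)
    also have "\<dots> \<in> borel_measurable (M \<Otimes>\<^sub>M lborel)"
      by measurable
    finally have [measurable]: "(\<lambda>p. indicator {..snd p} (fst p) :: real) \<in> borel_measurable (M \<Otimes>\<^sub>M lborel)" .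
    show ?thesis unfolding case_prod_beta' by measurable
  qed
  have int_k: "integrable lborel (?k y)" for y
    using measurable_Pair2[OF meas, of y]
    by (intro Bochner_Integration.integrable_bound[OF icc])
       (auto simp: norm_mult split: split_indicator)
  have int: "integrable (M \<Otimes>\<^sub>M lborel) (case_prod ?k)"
  proof (rule PL.Fubini_integrable[OF meas])
    show "integrable M (\<lambda>y. LINT x|lborel. norm (case (y, x) of (y, x) \<Rightarrow> ?k y x))"
    proof (rule integrable_const_bound)
      show "AE y in M. norm (LINT x|lborel. norm (case (y, x) of (y, x) \<Rightarrow> ?k y x)) \<le> (LINT x|lborel. indicator {-R..R} x)"
      proof (intro AE_I2)
        fix y
        have "norm (LINT x|lborel. norm (?k y x)) = (LINT x|lborel. norm (?k y x))"
          by simp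
        also have "\<dots> \<le> (LINT x|lborel. indicator {-R..R} x)"
          by (rule integral_mono[OF integrable_norm[OF int_k] icc]) (auto simp: norm_mult split: split_indicator)
        finally show "norm (LINT x|lborel. norm (case (y, x) of (y, x) \<Rightarrow> ?k y x)) \<le> (LINT x|lborel. indicator {-R..R} x)"
          by simp
      qed
    qed (use meas in measurable)
  qed (use int_k in auto)
  have inner: "\<i> * complex_of_real \<omega> * (CLINT x|lborel. ?k y x)
      = iexp (- (\<omega> * max (-R) (min R y))) - iexp (- (\<omega> * R))" for y
  proof -
    let ?c = "max (-R) (min R y)"
    have "(CLINT x|lborel. ?k y x) = (CLINT x|lborel. indicator {?c..R} x *\<^sub>R iexp (- (\<omega> * x)))"
    proof (rule integral_cong_AE[OF borel_measurable_integrable[OF int_k]])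
      \<comment> \<open>For \<open>y > R\<close> the left set is empty while the right one is the
        point \<open>R\<close>, so equality holds only off \<open>R\<close>.\<close>
      show "AE x in lborel. ?k y x = indicator {?c..R} x *\<^sub>R iexp (- (\<omega> * x))"
        using AE_lborel_singleton[of R] by eventually_elim (auto split: split_indicator)
    qed measurable
    then show ?thesis
      using iexp_times_integral_Icc[of ?c R \<omega>] assms by simp
  qed
  have "(CLINT x|lborel. indicator {-R..R} x *\<^sub>R (complex_of_real (cdf M x) * iexp (- (\<omega> * x))))
      = (CLINT x|lborel. CLINT y|M. ?k y x)"
  proof (intro Bochner_Integration.integral_cong refl)
    fix x
    have "complex_of_real (cdf M x) = (CLINT y|M. complex_of_real (indicator {..x} y))"
      by (simp only: cdf_eq_integral integral_complex_of_real)
    then show "indicator {-R..R} x *\<^sub>R (complex_of_real (cdf M x) * iexp (- (\<omega> * x))) = (CLINT y|M. ?k y x)"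
      by simp
  qed
  also have "\<dots> = (CLINT y|M. CLINT x|lborel. ?k y x)"
    by (rule PL.Fubini_integral[OF int])
  finally have "\<i> * complex_of_real \<omega> * (CLINT x|lborel. indicator {-R..R} x *\<^sub>R (complex_of_real (cdf M x) * iexp (- (\<omega> * x))))
      = (CLINT y|M. \<i> * complex_of_real \<omega> * (CLINT x|lborel. ?k y x))"
    by simp
  also have "\<dots> = (CLINT y|M. iexp (- (\<omega> * max (-R) (min R y))) - iexp (- (\<omega> * R)))"
    by (simp only: inner)
  also have "\<dots> = (CLINT y|M. iexp (- (\<omega> * max (-R) (min R y)))) - iexp (- (\<omega> * R))"
    by (subst Bochner_Integration.integral_diff)
       (auto intro!: integrable_const_bound[of _ 1] simp: prob_space simp del: space_eq_univ of_real_minus of_real_mult)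
  finally show ?thesis .
qed

lemma char_uminus: "char M (- t) = cnj (char M t)"
proof -
  have "char M (- t) = (CLINT x|M. cnj (iexp (t * x)))"
    unfolding char_def by (intro Bochner_Integration.integral_cong refl) (simp add: exp_cnj)
  also have "\<dots> = cnj (char M t)"
    unfolding char_def by (rule Bochner_Integration.integral_cnj)
  finally show ?thesis .
qed

text \<open>Dominated convergence with the constant 1: for each \<open>y\<close> the clamping has no
  effect once \<open>n\<close> reaches the absolute value of \<open>y\<close>. The conjugate comes
  from the opposite signs in the exponents of the Fourier transform and of
  \<open>char\<close>.\<close>

lemma clamped_char_tendsto:
  "(\<lambda>n. CLINT y|M. iexp (- (\<omega> * max (- real n) (min (real n) y)))) \<longlonglongrightarrow> cnj (char M \<omega>)"
proof -
  have "(\<lambda>n. CLINT y|M. iexp (- (\<omega> * max (- real n) (min (real n) y)))) \<longlonglongrightarrow> (CLINT y|M. iexp (- (\<omega> * y)))"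
  proof (rule integral_dominated_convergence[where w = "\<lambda>_. 1"])
    show "AE y in M. (\<lambda>n. iexp (- (\<omega> * max (- real n) (min (real n) y)))) \<longlonglongrightarrow> iexp (- (\<omega> * y))"
    proof (intro AE_I2)
      fix y :: real
      obtain N :: nat where "\<bar>y\<bar> \<le> real N"
        using real_arch_simple by blast
      then have "max (- real n) (min (real n) y) = y" if "n \<ge> N" for n
        using that by (auto simp: max_def min_def abs_le_iff)
      then have "eventually (\<lambda>n. iexp (- (\<omega> * max (- real n) (min (real n) y))) = iexp (- (\<omega> * y))) sequentially"
        by (auto simp: eventually_sequentially intro!: exI[of _ N])
      then show "(\<lambda>n. iexp (- (\<omega> * max (- real n) (min (real n) y)))) \<longlonglongrightarrow> iexp (- (\<omega> * y))"
        by (rule tendsto_eventually)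
    qed
  qed (auto simp del: of_real_minus of_real_mult)
  also have "(CLINT y|M. iexp (- (\<omega> * y))) = cnj (char M \<omega>)"
    unfolding char_uminus[symmetric] by (simp add: char_def)
  finally show ?thesis .
qed

end

section \<open>From pointwise to L2 limits of truncated transforms\<close>

lemma truncated_fourier_eq:
  "truncated_fourier R f \<omega> = complex_of_real (1 / sqrt (2 * pi)) * fourier_int (\<lambda>x. indicator {-R..R} x *\<^sub>R f x) \<omega>"
  by (simp add: truncated_fourier_def fourier_int_def set_lebesgue_integral_def)

lemma truncated_fourier_measurable [measurable]:
  assumes [measurable]: "f \<in> borel_measurable lborel"
  shows "truncated_fourier R f \<in> borel_measurable lborel"
  unfolding truncated_fourier_eq[abs_def] by measurable

text \<open>Since \<open>t \<le> 1 + t\<^sup>2\<close>, the indicator plus the squared modulus of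
  \<open>f\<close> is an integrable majorant.\<close>

lemma square_integrable_imp_integrable_Icc:
  assumes "square_integrable f"
  shows "integrable lborel (\<lambda>x. indicator {a..b} x *\<^sub>R f x)"
proof (rule Bochner_Integration.integrable_bound)
  have "integrable lborel (indicator {a..b} :: real \<Rightarrow> real)"
    by (rule integrable_indicator_Icc)
  then show "integrable lborel (\<lambda>x. indicator {a..b} x + (cmod (f x))\<^sup>2)"
    using assms by (auto simp: square_integrable_def)
  show "(\<lambda>x. indicator {a..b} x *\<^sub>R f x) \<in> borel_measurable lborel"
    using assms by (auto simp: square_integrable_def)
  have "t \<le> 1 + t\<^sup>2" for t :: real
    using zero_le_power2[of "t - 1/2"] by (simp add: power2_eq_square algebra_simps)
  then show "AE x in lborel. norm (indicator {a..b} x *\<^sub>R f x) \<le> norm (indicator {a..b} x + (cmod (f x))\<^sup>2)"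
    by (auto split: split_indicator)
qed

text \<open>The L2 bound applied to the difference of two truncations, the normalisation cancelling
  its factor 2 pi. The bound is independent of \<open>S\<close>, so \<open>S\<close> can be sent to
  infinity.\<close>

lemma truncated_fourier_diff_L2_bound:
  assumes f: "square_integrable f" and "R \<le> S"
  shows "(\<integral>\<^sup>+\<omega>. ennreal ((cmod (truncated_fourier R f \<omega> - truncated_fourier S f \<omega>))\<^sup>2) \<partial>lborel)
    \<le> (\<integral>\<^sup>+x. ennreal (indicator (- {-R..R}) x * (cmod (f x))\<^sup>2) \<partial>lborel)"
proof -
  let ?t = "\<lambda>R x. indicator {-R..R} x *\<^sub>R f x"
  have [measurable]: "f \<in> borel_measurable lborel"
    using f by (simp add: square_integrable_def)
  have int: "integrable lborel (?t R)" for R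
    by (rule square_integrable_imp_integrable_Icc[OF f])
  have diff: "truncated_fourier R f \<omega> - truncated_fourier S f \<omega>
      = complex_of_real (1 / sqrt (2 * pi)) * fourier_int (\<lambda>x. ?t R x - ?t S x) \<omega>" for \<omega>
  proof -
    have "fourier_int (\<lambda>x. ?t R x - ?t S x) \<omega> = fourier_int (?t R) \<omega> - fourier_int (?t S) \<omega>"
      unfolding fourier_int_def left_diff_distrib
      by (intro Bochner_Integration.integral_diff integrable_times_iexp int) measurable
    then show ?thesis
      by (simp only: truncated_fourier_eq right_diff_distrib)
  qed
  have "(\<integral>\<^sup>+\<omega>. ennreal ((cmod (truncated_fourier R f \<omega> - truncated_fourier S f \<omega>))\<^sup>2) \<partial>lborel)
      = (\<integral>\<^sup>+\<omega>. ennreal (1 / (2 * pi)) * ennreal ((cmod (fourier_int (\<lambda>x. ?t R x - ?t S x) \<omega>))\<^sup>2) \<partial>lborel)"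
    unfolding diff norm_mult power_mult_distrib
    by (intro nn_integral_cong) (simp add: ennreal_mult'[symmetric] norm_divide power_divide)
  also have "\<dots> = ennreal (1 / (2 * pi)) * (\<integral>\<^sup>+\<omega>. ennreal ((cmod (fourier_int (\<lambda>x. ?t R x - ?t S x) \<omega>))\<^sup>2) \<partial>lborel)"
    by (rule nn_integral_cmult) measurable
  also have "\<dots> \<le> ennreal (1 / (2 * pi)) * (ennreal (2 * pi) * (\<integral>\<^sup>+x. ennreal ((cmod (?t R x - ?t S x))\<^sup>2) \<partial>lborel))"
    by (intro mult_left_mono fourier_int_L2_bound Bochner_Integration.integrable_diff int) auto
  also have "\<dots> = (\<integral>\<^sup>+x. ennreal ((cmod (?t R x - ?t S x))\<^sup>2) \<partial>lborel)"
    by (simp only: mult.assoc[symmetric] ennreal_mult'[symmetric]) (simp flip: ennreal_mult')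
  also have "\<dots> \<le> (\<integral>\<^sup>+x. ennreal (indicator (- {-R..R}) x * (cmod (f x))\<^sup>2) \<partial>lborel)"
    using \<open>R \<le> S\<close> by (intro nn_integral_mono ennreal_leI) (auto split: split_indicator)
  finally show ?thesis .
qed

text \<open>Letting the larger radius tend to infinity in the Cauchy estimate, by Fatou, bounds the
  L2 distance from each truncated transform to the pointwise limit by the tail of \<open>f\<close>,
  which vanishes as the radius grows.\<close>

lemma
  assumes f: "square_integrable f"
    and lim: "AE \<omega> in lborel. (\<lambda>n. truncated_fourier (real n) f \<omega>) \<longlonglongrightarrow> ft H \<omega>"
  shows square_integrable_pointwise_limit: "square_integrable (ft H)"
    and L2_elem_eq_pointwise_limit: "L2_elem f = H"
proof -
  have [measurable]: "f \<in> borel_measurable lborel" and f2: "integrable lborel (\<lambda>x. (cmod (f x))\<^sup>2)"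
    using f by (auto simp: square_integrable_def)
  let ?d = "\<lambda>R. \<integral>\<^sup>+\<omega>. ennreal ((cmod (truncated_fourier R f \<omega> - ft H \<omega>))\<^sup>2) \<partial>lborel"
  let ?T = "\<lambda>R. LINT x|lborel. indicator (- {-R..R}) x * (cmod (f x))\<^sup>2"
  have T: "(\<integral>\<^sup>+x. ennreal (indicator (- {-R..R}) x * (cmod (f x))\<^sup>2) \<partial>lborel) = ennreal (?T R)" for R
    by (intro nn_integral_eq_integral Bochner_Integration.integrable_bound[OF f2])
       (auto split: split_indicator)
  have bound: "?d R \<le> ennreal (?T R)" for R
  proof -
    \<comment> \<open>The shift by \<open>N\<close> keeps every radius \<open>n + N\<close> at or
      above \<open>R\<close>, as the Cauchy estimate requires.\<close>
    obtain N :: nat where N: "R \<le> real N"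
      using real_arch_simple by blast
    let ?u = "\<lambda>n \<omega>. ennreal ((cmod (truncated_fourier R f \<omega> - truncated_fourier (real (n + N)) f \<omega>))\<^sup>2)"
    show ?thesis
    proof (rule nn_integral_le_of_tendsto)
      show "?u n \<in> borel_measurable lborel" for n
        by measurable
      show "AE \<omega> in lborel. (\<lambda>n. ?u n \<omega>) \<longlonglongrightarrow> ennreal ((cmod (truncated_fourier R f \<omega> - ft H \<omega>))\<^sup>2)"
        using lim
      proof eventually_elim
        case (elim \<omega>)
        show ?case
          by (intro tendsto_intros LIMSEQ_ignore_initial_segment[OF elim])
      qed
      show "(\<integral>\<^sup>+\<omega>. ?u n \<omega> \<partial>lborel) \<le> ennreal (?T R)" for n
        using truncated_fourier_diff_L2_bound[OF f, of R "real (n + N)"] N unfolding T by simp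
    qed
  qed
  \<comment> \<open>Truncation to the null set {0} has transform 0, so the bound at radius 0 shows
    that the limit is square-integrable.\<close>
  have "truncated_fourier 0 f \<omega> = 0" for \<omega>
  proof -
    have "fourier_int (\<lambda>x. indicator {-0..0} x *\<^sub>R f x) \<omega> = (CLINT x|(lborel :: real measure). 0)"
      unfolding fourier_int_def
    proof (rule integral_cong_AE)
      show "AE x in lborel. (indicator {-0..0} x *\<^sub>R f x) * iexp (- (\<omega> * x)) = 0"
        using AE_lborel_singleton[of 0] by eventually_elim (simp split: split_indicator)
    qed measurable
    then show ?thesis by (simp add: truncated_fourier_eq)
  qed
  then have "(\<integral>\<^sup>+\<omega>. ennreal ((cmod (ft H \<omega>))\<^sup>2) \<partial>lborel) \<le> ennreal (?T 0)"
    using bound[of 0] by simp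
  also have "\<dots> < \<infinity>" by simp
  finally show sq: "square_integrable (ft H)"
    by (auto simp: square_integrable_def integrable_iff_bounded)
  have "(?T \<longlongrightarrow> (LINT x|(lborel :: real measure). 0)) at_top"
  proof (rule integral_dominated_convergence_at_top[OF _ _ f2])
    show "AE x in lborel. ((\<lambda>R. indicator (- {-R..R}) x * (cmod (f x))\<^sup>2) \<longlongrightarrow> 0) at_top"
    proof (rule AE_I2)
      fix x
      have "eventually (\<lambda>R. indicator (- {-R..R}) x * (cmod (f x))\<^sup>2 = 0) at_top"
        using eventually_ge_at_top[of "\<bar>x\<bar>"] by eventually_elim (auto split: split_indicator)
      then show "((\<lambda>R. indicator (- {-R..R}) x * (cmod (f x))\<^sup>2) \<longlongrightarrow> 0) at_top"
        by (rule tendsto_eventually)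
    qed
  qed (auto split: split_indicator)
  then have "((\<lambda>R. ennreal (?T R)) \<longlongrightarrow> ennreal 0) at_top"
    by (intro tendsto_ennrealI) simp
  then have "(?d \<longlongrightarrow> 0) at_top"
    using bound by (intro tendsto_sandwich[where f = "\<lambda>_. 0" and g = ?d and h = "\<lambda>R. ennreal (?T R)"]) auto
  then show "L2_elem f = H"
    using sq by (intro L2_elem_eqI) auto
qed

text \<open>The weight of \<open>H_cdf\<close> is at most 1.\<close>

lemma square_integrable_imp_H_cdf:
  assumes "square_integrable (ft H)" "\<epsilon> > 0"
  shows "H \<in> H_cdf \<epsilon>"
proof -
  have "(\<integral>\<^sup>+\<omega>. ennreal (\<omega>\<^sup>2 / (\<omega>\<^sup>2 + \<epsilon>) * (cmod (ft H \<omega>))\<^sup>2) \<partial>lborel)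
      \<le> (\<integral>\<^sup>+\<omega>. ennreal ((cmod (ft H \<omega>))\<^sup>2) \<partial>lborel)"
    using assms(2) by (intro nn_integral_mono ennreal_leI mult_left_le_one_le)
       (auto simp: divide_le_eq add_nonneg_pos)
  also have "\<dots> < \<infinity>"
    using assms(1) by (simp add: square_integrable_def integrable_iff_bounded)
  finally show ?thesis by (simp add: H_cdf_def)
qed

section \<open>The transform of a difference of distribution functions\<close>

lemma square_integrable_cdf_diff:
  assumes "cdf P1 \<in> Gamma_F" "cdf P2 \<in> Gamma_F"
  shows "square_integrable (\<lambda>x. complex_of_real (cdf P1 x - cdf P2 x))"
proof -
  let ?d = "\<lambda>P x. complex_of_real (cdf P x - indicator {0..} x)"
  have d: "square_integrable (?d P1)" "square_integrable (?d P2)"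
    using assms by (auto simp: Gamma_F_def)
  have m: "?d P1 \<in> borel_measurable lborel" "?d P2 \<in> borel_measurable lborel"
    using d unfolding square_integrable_def by blast+
  have eq: "complex_of_real (cdf P1 x - cdf P2 x) = ?d P1 x - ?d P2 x" for x
    by simp
  have meas: "(\<lambda>x. complex_of_real (cdf P1 x - cdf P2 x)) \<in> borel_measurable lborel"
    unfolding eq by (rule borel_measurable_diff[OF m])
  have "integrable lborel (\<lambda>x. 2 * (cmod (?d P1 x))\<^sup>2 + 2 * (cmod (?d P2 x))\<^sup>2)"
    using d unfolding square_integrable_def by (intro Bochner_Integration.integrable_add integrable_mult_right) auto
  then have "integrable lborel (\<lambda>x. (cmod (complex_of_real (cdf P1 x - cdf P2 x)))\<^sup>2)"
  proof (rule Bochner_Integration.integrable_bound)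
    show "AE x in lborel. norm ((cmod (complex_of_real (cdf P1 x - cdf P2 x)))\<^sup>2)
        \<le> norm (2 * (cmod (?d P1 x))\<^sup>2 + 2 * (cmod (?d P2 x))\<^sup>2)"
    proof (rule AE_I2)
      fix x
      have "(a - b)\<^sup>2 \<le> 2 * a\<^sup>2 + 2 * b\<^sup>2" for a b :: real
        using zero_le_power2[of "a + b"] by (simp add: power2_eq_square algebra_simps)
      from this[of "cdf P1 x - indicator {0..} x" "cdf P2 x - indicator {0..} x"]
      show "norm ((cmod (complex_of_real (cdf P1 x - cdf P2 x)))\<^sup>2)
        \<le> norm (2 * (cmod (?d P1 x))\<^sup>2 + 2 * (cmod (?d P2 x))\<^sup>2)"
        unfolding norm_of_real real_norm_def power2_abs by simp
    qed
  qed (use meas in measurable)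
  then show ?thesis using meas by (simp add: square_integrable_def)
qed

text \<open>Taking the difference of \<open>fourier_truncated_cdf\<close> for the two laws and
  dividing by \<open>\<i> * \<omega>\<close> expresses the truncated transform by the clamped
  characteristic functions, whose limits are known.\<close>

lemma truncated_fourier_cdf_diff_tendsto:
  assumes P: "real_distribution P1" "real_distribution P2" and \<omega>: "\<omega> \<noteq> 0"
    and f: "square_integrable (\<lambda>x. complex_of_real (cdf P1 x - cdf P2 x))"
  shows "(\<lambda>n. truncated_fourier (real n) (\<lambda>x. complex_of_real (cdf P1 x - cdf P2 x)) \<omega>)
    \<longlonglongrightarrow> cnj (char P1 \<omega> - char P2 \<omega>) / (complex_of_real (sqrt (2 * pi)) * \<i> * complex_of_real \<omega>)"
proof -
  interpret P1: real_distribution P1 by fact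
  interpret P2: real_distribution P2 by fact
  let ?E = "\<lambda>P n. CLINT y|P. iexp (- (\<omega> * max (- real n) (min (real n) y)))"
  let ?c = "complex_of_real (sqrt (2 * pi)) * \<i> * complex_of_real \<omega>"
  let ?F = "\<lambda>P n x. indicator {- real n..real n} x *\<^sub>R (complex_of_real (cdf P x) * iexp (- (\<omega> * x)))"
  have int: "integrable lborel (?F P n)" if "real_distribution P" for P n
  proof -
    interpret P: real_distribution P by fact
    have "integrable lborel (indicator {- real n..real n} :: real \<Rightarrow> real)"
      by (rule integrable_indicator_Icc)
    then show ?thesis
      by (rule Bochner_Integration.integrable_bound)
         (auto simp: norm_mult P.cdf_nonneg P.cdf_bounded_prob split: split_indicator)
  qed
  have eq: "truncated_fourier (real n) (\<lambda>x. complex_of_real (cdf P1 x - cdf P2 x)) \<omega> = (?E P1 n - ?E P2 n) / ?c" for n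
  proof -
    have "complex_of_real (sqrt (2 * pi)) * truncated_fourier (real n) (\<lambda>x. complex_of_real (cdf P1 x - cdf P2 x)) \<omega>
        = (CLINT x|lborel. ?F P1 n x - ?F P2 n x)"
      by (simp add: truncated_fourier_eq fourier_int_def algebra_simps)
    also have "\<dots> = (CLINT x|lborel. ?F P1 n x) - (CLINT x|lborel. ?F P2 n x)"
      by (intro Bochner_Integration.integral_diff int P)
    finally have "?c * truncated_fourier (real n) (\<lambda>x. complex_of_real (cdf P1 x - cdf P2 x)) \<omega>
        = \<i> * complex_of_real \<omega> * (CLINT x|lborel. ?F P1 n x) - \<i> * complex_of_real \<omega> * (CLINT x|lborel. ?F P2 n x)"
      by (simp only: right_diff_distrib mult_ac)
    \<comment> \<open>The boundary terms at \<open>real n\<close> cancel here.\<close>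
    also have "\<dots> = ?E P1 n - ?E P2 n"
      by (simp only: P1.fourier_truncated_cdf P2.fourier_truncated_cdf of_nat_0_le_iff) simp
    finally show ?thesis using \<omega> by (simp add: field_simps)
  qed
  show ?thesis
    unfolding eq complex_cnj_diff using \<omega>
    by (intro tendsto_divide tendsto_diff P1.clamped_char_tendsto P2.clamped_char_tendsto tendsto_const) auto
qed

lemma ft_add: "AE \<omega> in lborel. ft (H + K) \<omega> = ft H \<omega> + ft K \<omega>"
  using ft_of_ft[of "\<lambda>\<omega>. ft H \<omega> + ft K \<omega>"] by (simp add: plus_ft_class_def)

lemma ft_diff: "AE \<omega> in lborel. ft (H - K) \<omega> = ft H \<omega> - ft K \<omega>"
  using ft_of_ft[of "\<lambda>\<omega>. ft H \<omega> - ft K \<omega>"] by (simp add: minus_ft_class_def)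

lemma ft_scale: "AE \<omega> in lborel. ft (c *\<^sub>F H) \<omega> = c * ft H \<omega>"
  using ft_of_ft[of "\<lambda>\<omega>. c * ft H \<omega>"] by (simp add: scale_ft_def)

text \<open>The explicit pointwise limit \<open>?g\<close> is the Plancherel transform. Conjugating
  it and multiplying by the factor of \<open>U_map\<close> leaves the difference of the
  characteristic functions, in which the constants 1 of the two \<open>Phi\<close> have
  cancelled.\<close>

lemma U_map_L2_elem_cdf_diff:
  assumes \<epsilon>: "\<epsilon> > 0" and P: "real_distribution P1" "real_distribution P2"
    and \<Gamma>: "cdf P1 \<in> Gamma_F" "cdf P2 \<in> Gamma_F"
  defines "H \<equiv> L2_elem (\<lambda>x. complex_of_real (cdf P1 x - cdf P2 x))"
  shows "H \<in> H_cdf \<epsilon>" "U_map H = Phi P1 - Phi P2"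
proof -
  let ?g = "\<lambda>\<omega>. cnj (char P1 \<omega> - char P2 \<omega>) / (complex_of_real (sqrt (2 * pi)) * \<i> * complex_of_real \<omega>)"
  note [measurable] = cnj_measurable real_distribution.char_measurable[OF P(1)] real_distribution.char_measurable[OF P(2)]
  have sq: "square_integrable (\<lambda>x. complex_of_real (cdf P1 x - cdf P2 x))"
    by (rule square_integrable_cdf_diff[OF \<Gamma>])
  have ft_g: "AE \<omega> in lborel. ft (of_ft ?g) \<omega> = ?g \<omega>"
    by (rule ft_of_ft) measurable
  have "AE \<omega> in lborel. \<omega> \<noteq> (0 :: real)"
    by (rule AE_lborel_singleton)
  with ft_g have lim: "AE \<omega> in lborel. (\<lambda>n. truncated_fourier (real n) (\<lambda>x. complex_of_real (cdf P1 x - cdf P2 x)) \<omega>) \<longlonglongrightarrow> ft (of_ft ?g) \<omega>"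
    by eventually_elim (simp only: truncated_fourier_cdf_diff_tendsto[OF P _ sq] not_False_eq_True)
  have H: "H = of_ft ?g"
    unfolding H_def by (rule L2_elem_eq_pointwise_limit[OF sq lim])
  show "H \<in> H_cdf \<epsilon>"
    unfolding H by (rule square_integrable_imp_H_cdf[OF square_integrable_pointwise_limit[OF sq lim] \<epsilon>])
  show "U_map H = Phi P1 - Phi P2"
    unfolding ft_class_eq_iff
    using ft_U_map[of H] ft_g[folded H] ft_diff[of "Phi P1" "Phi P2"] ft_Phi[OF P(1)] ft_Phi[OF P(2)]
      AE_lborel_singleton[of 0]
    by eventually_elim simp
qed

section \<open>The point mass at 0\<close>

lemma real_distribution_return: "real_distribution (return borel x)"
  by (simp add: real_distribution_def real_distribution_axioms_def prob_space_return)

lemma cdf_return_0: "cdf (return borel 0) x = indicator {0..} x"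
  by (simp add: cdf_def measure_return split: split_indicator)

lemma cdf_return_0_Gamma_F: "cdf (return borel 0) \<in> Gamma_F"
  using real_distribution_return[of 0]
  by (auto simp: Gamma_F_def square_integrable_def cdf_return_0)

text \<open>With the point mass as second law, the formula for differences becomes the one for a
  single law.\<close>

lemma Phi_return_0: "Phi (return borel 0) = 0"
proof -
  have "char (return borel 0) \<omega> = 1" for \<omega>
    by (simp add: char_def integral_return)
  then show ?thesis
    by (simp add: Phi_def zero_ft_class_def)
qed

section \<open>The inverse map and the isometry\<close>

definition U_inv :: "ft_class \<Rightarrow> ft_class" where
  "U_inv f = of_ft (\<lambda>\<omega>. 1 / (complex_of_real (sqrt (2 * pi)) * \<i> * complex_of_real \<omega>) * cnj (ft f \<omega>))"

lemma ft_U_inv: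
  "AE \<omega> in lborel. ft (U_inv f) \<omega> =
     1 / (complex_of_real (sqrt (2 * pi)) * \<i> * complex_of_real \<omega>) * cnj (ft f \<omega>)"
  unfolding U_inv_def
proof (rule ft_of_ft)
  note [measurable] = cnj_measurable
  show "(\<lambda>\<omega>. 1 / (complex_of_real (sqrt (2 * pi)) * \<i> * complex_of_real \<omega>) * cnj (ft f \<omega>)) \<in> borel_measurable lborel"
    by measurable
qed

text \<open>Off \<omega> = 0 the two factors cancel after conjugation. At 0 the division yields 0,
  which affects only a null set.\<close>

lemma U_map_U_inv: "U_map (U_inv f) = f"
  unfolding ft_class_eq_iff using ft_U_map[of "U_inv f"] ft_U_inv[of f] AE_lborel_singleton[of 0]
  by eventually_elim simp

lemma U_inv_U_map: "U_inv (U_map H) = H"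
  unfolding ft_class_eq_iff using ft_U_inv[of "U_map H"] ft_U_map[of H] AE_lborel_singleton[of 0]
  by eventually_elim simp

lemma conj_linear_U_map: "conj_linear_on V U_map"
  unfolding conj_linear_on_def
proof (intro conjI ballI allI)
  fix H K
  show "U_map (H + K) = U_map H + U_map K"
    unfolding ft_class_eq_iff
    using ft_U_map[of "H + K"] ft_U_map[of H] ft_U_map[of K] ft_add[of H K] ft_add[of "U_map H" "U_map K"]
    by eventually_elim (simp only: complex_cnj_add distrib_left)
next
  fix c H
  show "U_map (c *\<^sub>F H) = cnj c *\<^sub>F U_map H"
    unfolding ft_class_eq_iff
    using ft_U_map[of "c *\<^sub>F H"] ft_U_map[of H] ft_scale[of c H] ft_scale[of "cnj c" "U_map H"]
    by eventually_elim simp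
qed

text \<open>The squared modulus of the multiplier is \<open>2 * pi * \<omega>\<^sup>2\<close>. This
  turns one weight into the other, and 2 pi cancels against the normalisation in
  \<open>norm_eps\<close>. Membership and isometry both rest on this identity.\<close>

lemma U_map_weight:
  "AE \<omega> in lborel. (cmod (ft (U_map H) \<omega>))\<^sup>2 / (\<omega>\<^sup>2 + \<epsilon>) = 2 * pi * (\<omega>\<^sup>2 / (\<omega>\<^sup>2 + \<epsilon>) * (cmod (ft H \<omega>))\<^sup>2)"
  using ft_U_map[of H] by eventually_elim (simp add: norm_mult power_mult_distrib)

text \<open>The direction from left to right, applied to \<open>U_inv f\<close>, shows that the
  inverse lands in \<open>H_cdf\<close>.\<close>

lemma U_map_in_H_eps_iff:
  assumes "\<epsilon> > 0"
  shows "U_map H \<in> H_eps \<epsilon> \<longleftrightarrow> H \<in> H_cdf \<epsilon>"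
proof -
  have "(\<integral>\<^sup>+\<omega>. ennreal ((cmod (ft (U_map H) \<omega>))\<^sup>2 / (\<omega>\<^sup>2 + \<epsilon>)) \<partial>lborel)
      = (\<integral>\<^sup>+\<omega>. ennreal (2 * pi) * ennreal (\<omega>\<^sup>2 / (\<omega>\<^sup>2 + \<epsilon>) * (cmod (ft H \<omega>))\<^sup>2) \<partial>lborel)"
    using U_map_weight[of H \<epsilon>]
    by (intro nn_integral_cong_AE, eventually_elim) (simp only: ennreal_mult' pi_ge_zero mult_nonneg_nonneg zero_le_numeral)
  also have "\<dots> = ennreal (2 * pi) * (\<integral>\<^sup>+\<omega>. ennreal (\<omega>\<^sup>2 / (\<omega>\<^sup>2 + \<epsilon>) * (cmod (ft H \<omega>))\<^sup>2) \<partial>lborel)"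
    by (rule nn_integral_cmult) measurable
  finally show ?thesis
    by (auto simp: H_eps_def H_cdf_def ennreal_mult_less_top)
qed

lemma norm_eps_U_map: "norm_eps \<epsilon> (U_map H) = norm_cdf \<epsilon> H"
proof -
  have "(LINT \<omega>|lborel. (cmod (ft (U_map H) \<omega>))\<^sup>2 / (\<omega>\<^sup>2 + \<epsilon>))
      = (LINT \<omega>|lborel. 2 * pi * (\<omega>\<^sup>2 / (\<omega>\<^sup>2 + \<epsilon>) * (cmod (ft H \<omega>))\<^sup>2))"
    by (rule integral_cong_AE[OF _ _ U_map_weight]) measurable
  also have "\<dots> = 2 * pi * (LINT \<omega>|lborel. \<omega>\<^sup>2 / (\<omega>\<^sup>2 + \<epsilon>) * (cmod (ft H \<omega>))\<^sup>2)"
    by (rule integral_mult_right_zero)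
  finally show ?thesis
    by (simp add: norm_eps_def norm_cdf_def)
qed

theorem theorem6:
  fixes \<epsilon> :: real
  assumes "\<epsilon> > 0"
  shows
    "(conj_linear_on (H_cdf \<epsilon>) U_map \<and>
      bij_betw U_map (H_cdf \<epsilon>) (H_eps \<epsilon>) \<and>
      (\<forall>H \<in> H_cdf \<epsilon>. norm_eps \<epsilon> (U_map H) = norm_cdf \<epsilon> H))
     \<and>
     ((\<forall>P1 P2. real_distribution P1 \<and> real_distribution P2 \<and>
          cdf P1 \<in> Gamma_F \<and> cdf P2 \<in> Gamma_F \<longrightarrow>
          L2_elem (\<lambda>x. complex_of_real (cdf P1 x - cdf P2 x)) \<in> H_cdf \<epsilon> \<and>
          U_map (L2_elem (\<lambda>x. complex_of_real (cdf P1 x - cdf P2 x))) = Phi P1 - Phi P2) \<and>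
      (\<forall>P. real_distribution P \<and> cdf P \<in> Gamma_F \<longrightarrow>
          L2_elem (\<lambda>x. complex_of_real (cdf P x - indicator {0..} x)) \<in> H_cdf \<epsilon> \<and>
          Phi P \<in> H_eps \<epsilon> \<and>
          Phi P = U_map (L2_elem (\<lambda>x. complex_of_real (cdf P x - indicator {0..} x)))))
     \<and>
     (U_map ` H_cdf \<epsilon> = H_eps \<epsilon> \<and>
      (\<exists>Uinv. Uinv ` H_eps \<epsilon> \<subseteq> H_cdf \<epsilon> \<and>
         (\<forall>H \<in> H_cdf \<epsilon>. Uinv (U_map H) = H) \<and>
         (\<forall>f \<in> H_eps \<epsilon>. U_map (Uinv f) = f) \<and>
         (\<exists>C. \<forall>f \<in> H_eps \<epsilon>. norm_cdf \<epsilon> (Uinv f) \<le> C * norm_eps \<epsilon> f) \<and>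
         (\<forall>f \<in> H_eps \<epsilon>. AE \<omega> in lborel.
            ft (Uinv f) \<omega> =
              1 / (complex_of_real (sqrt (2 * pi)) * \<i> * complex_of_real \<omega>) * cnj (ft f \<omega>)) \<and>
         (\<forall>f \<in> H_eps \<epsilon>. norm_cdf \<epsilon> (Uinv f) = norm_eps \<epsilon> f)))"
proof -
  note \<epsilon> = assms
  have U_inv_in: "U_inv f \<in> H_cdf \<epsilon>" if "f \<in> H_eps \<epsilon>" for f
    using that U_map_in_H_eps_iff[OF \<epsilon>, of "U_inv f"] by (simp add: U_map_U_inv)
  have norm_inv: "norm_cdf \<epsilon> (U_inv f) = norm_eps \<epsilon> f" for f
    using norm_eps_U_map[of \<epsilon> "U_inv f"] by (simp add: U_map_U_inv)
  have lin: "conj_linear_on (H_cdf \<epsilon>) U_map"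
    by (rule conj_linear_U_map)
  have bij: "bij_betw U_map (H_cdf \<epsilon>) (H_eps \<epsilon>)"
    by (rule bij_betw_byWitness[where f' = U_inv])
       (auto simp: U_map_U_inv U_inv_U_map U_map_in_H_eps_iff[OF \<epsilon>] U_inv_in)
  have norm: "norm_eps \<epsilon> (U_map H) = norm_cdf \<epsilon> H" for H
    by (rule norm_eps_U_map)
  have diff: "L2_elem (\<lambda>x. complex_of_real (cdf P1 x - cdf P2 x)) \<in> H_cdf \<epsilon>"
    "U_map (L2_elem (\<lambda>x. complex_of_real (cdf P1 x - cdf P2 x))) = Phi P1 - Phi P2"
    if "real_distribution P1 \<and> real_distribution P2 \<and> cdf P1 \<in> Gamma_F \<and> cdf P2 \<in> Gamma_F" for P1 P2
    using that U_map_L2_elem_cdf_diff[OF \<epsilon>] by auto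
  have single: "L2_elem (\<lambda>x. complex_of_real (cdf P x - indicator {0..} x)) \<in> H_cdf \<epsilon>"
    "Phi P \<in> H_eps \<epsilon>"
    "Phi P = U_map (L2_elem (\<lambda>x. complex_of_real (cdf P x - indicator {0..} x)))"
    if "real_distribution P \<and> cdf P \<in> Gamma_F" for P
  proof -
    let ?H = "L2_elem (\<lambda>x. complex_of_real (cdf P x - indicator {0..} x))"
    \<comment> \<open>The general formula with the point mass at 0 as second law: its distribution
      function is the indicator and its \<open>Phi\<close> is 0.\<close>
    have H: "?H \<in> H_cdf \<epsilon>" "U_map ?H = Phi P"
      using that U_map_L2_elem_cdf_diff[OF \<epsilon> _ real_distribution_return _ cdf_return_0_Gamma_F, of P]
      by (simp_all add: cdf_return_0 Phi_return_0)
    show "?H \<in> H_cdf \<epsilon>" "Phi P = U_map ?H"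
      using H by simp_all
    show "Phi P \<in> H_eps \<epsilon>"
      using H U_map_in_H_eps_iff[OF \<epsilon>, of ?H] by simp
  qed
  \<comment> \<open>The bound holds with constant 1, because \<open>U_inv\<close> preserves
    norms.\<close>
  have inv: "U_inv ` H_eps \<epsilon> \<subseteq> H_cdf \<epsilon>" "\<exists>C. \<forall>f\<in>H_eps \<epsilon>. norm_cdf \<epsilon> (U_inv f) \<le> C * norm_eps \<epsilon> f"
    using U_inv_in by (auto simp: norm_inv intro!: exI[of _ 1])
  show ?thesis
  proof (intro conjI allI impI ballI exI[of _ U_inv])
    show "U_map ` H_cdf \<epsilon> = H_eps \<epsilon>"
      by (rule bij_betw_imp_surj_on[OF bij])
  qed (rule lin bij norm diff single inv U_inv_U_map U_map_U_inv ft_U_inv norm_inv; assumption)+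
qed

end
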